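(* Consider the Hamiltonian system (of type $C_3^{(1)}$) $$\frac{dx}{dt}=\frac{\partial H}{\partial y},\quad \frac{dy}{dt}=-\frac{\partial H}{\partial x},\quad \frac{dz}{dt}=\frac{\partial H}{\partial w},\quad \frac{dw}{dt}=-\frac{\partial H}{\partial z}$$ with $$\begin{aligned} t^2H =\;&x^2y^3-(tx+2\alpha_1+\alpha_2+\alpha_3)xy^2-\{(\alpha_0 t-1)x-\alpha_1(\alpha_1+\alpha_2+\alpha_3)\}y-tx\\ &-\frac{z^2w^4}{4}+\frac{\alpha_3}{2}zw^3+\frac{1}{4}(2tz^2-\alpha_3^2)w^2-\frac{1}{2}\{(\alpha_3+1)t-1\}zw-\frac{t^2 z^2}{4}\\ &+(xy-\alpha_1)yzw, \end{aligned}$$ where the complex parameters satisfy $\alpha_0+2\alpha_1+2\alpha_2+\alpha_3=1$. Make the change of parameters and variables $$\alpha_0=A_0-A_1,\quad \alpha_1=A_1,\quad \alpha_2=A_2,\quad \alpha_3=A_3,$$ $$x=\frac{1}{X},\quad y=-(XY+A_1)X,\quad z=Z,\quad w=W$$ from $\alpha_0,\alpha_1,\alpha_2,\alpha_3,x,y,z,w$ to $A_0,A_1,A_2,A_3,X,Y,Z,W$. Then the system can also be written in the new variables $X,Y,Z,W$ and parameters $A_0,A_1,A_2,A_3$ as the polynomial Hamiltonian system given by $$\frac{dx}{dt}=\frac{\partial \tilde H}{\partial y},\quad \frac{dy}{dt}=-\frac{\partial \tilde H}{\partial x},\quad \frac{dz}{dt}=\frac{\partial \tilde H}{\partial w},\quad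 \frac{dw}{dt}=-\frac{\partial \tilde H}{\partial z}$$ with the polynomial Hamiltonian $$\begin{aligned} t^2\tilde H =\;&-tx(x-1)y^2+\{x^2+((\alpha_0+\alpha_1)t-1)x-\alpha_1 t\}y+(\alpha_2+\alpha_3)x-(\alpha_0 t-1)\alpha_1\\ &-\frac{z^2w^4}{4}+\frac{\alpha_3}{2}zw^3+\frac{1}{4}(2tz^2-\alpha_3^2)w^2-\frac{1}{2}\{(\alpha_0+\alpha_1+2\alpha_2+2\alpha_3)t-1\}zw-\frac{t^2 z^2}{4}\\ &-xzw, \end{aligned}$$ where, in this new system, for notational convenience $A_i,X,Y,Z,W$ have been renamed $\alpha_i,x,y,z,w$ (which are not the same as the previous $\alpha_i,x,y,z,w$); the new parameters satisfy $\alpha_0+\alpha_1+2\alpha_2+\alpha_3=1$.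
   Context: Here $x,y,z,w$ (and $X,Y,Z,W$) are unknown complex variables depending on $t$, and all parameters are complex. The tilde on $\tilde H$ only distinguishes the Hamiltonian of the new system from that of the original one.
   Formalization: The printed change x=1/X, y=-(XY+A_1)X does not carry H to the new Hamiltonian (a term -t/X remains); it is replaced by x=-(XY-A_1)Y, y=1/Y, z=Z, w=W with Y nonzero. The equivalence is stated for solutions on open sets of t not containing 0. *)

theory Defs
  imports "HOL-Analysis.Analysis"
begin

text \<open>
  A Hamiltonian is a function of the time and of the four variables, in the order
  \<open>t, x, y, z, w\<close>; the canonical pairs are \<open>(x, y)\<close> and \<open>(z, w)\<close>.
  Time and all variables are complex, so the derivatives are complex derivatives.
\<close>

definition solves_hamiltonian_system ::
  "(complex \<Rightarrow> complex \<Rightarrow> complex \<Rightarrow> complex \<Rightarrow> complex \<Rightarrow> complex) \<Rightarrow> complex set \<Rightarrow>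
   (complex \<Rightarrow> complex) \<Rightarrow> (complex \<Rightarrow> complex) \<Rightarrow> (complex \<Rightarrow> complex) \<Rightarrow> (complex \<Rightarrow> complex) \<Rightarrow> bool"
  where
  "solves_hamiltonian_system H S x y z w \<longleftrightarrow>
    (\<forall>t\<in>S.
      (x has_field_derivative   deriv (\<lambda>v. H t (x t) v (z t) (w t)) (y t)) (at t) \<and>
      (y has_field_derivative - deriv (\<lambda>u. H t u (y t) (z t) (w t)) (x t)) (at t) \<and>
      (z has_field_derivative   deriv (\<lambda>v. H t (x t) (y t) (z t) v) (w t)) (at t) \<and>
      (w has_field_derivative - deriv (\<lambda>u. H t (x t) (y t) u (w t)) (z t)) (at t))"

definition is_polynomial4 ::
  "(complex \<Rightarrow> complex \<Rightarrow> complex \<Rightarrow> complex \<Rightarrow> complex) \<Rightarrow> bool" where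
  "is_polynomial4 f \<longleftrightarrow>
    (\<exists>(I :: (nat \<times> nat \<times> nat \<times> nat) set) c. finite I \<and>
      (\<forall>x y z w. f x y z w = (\<Sum>(i, j, k, l)\<in>I. c i j k l * x ^ i * y ^ j * z ^ k * w ^ l)))"

definition H_C3 ::
  "complex \<Rightarrow> complex \<Rightarrow> complex \<Rightarrow> complex \<Rightarrow>
   complex \<Rightarrow> complex \<Rightarrow> complex \<Rightarrow> complex \<Rightarrow> complex \<Rightarrow> complex" where
  "H_C3 \<alpha>0 \<alpha>1 \<alpha>2 \<alpha>3 t x y z w =
    (x^2 * y^3 - (t * x + 2 * \<alpha>1 + \<alpha>2 + \<alpha>3) * x * y^2
       - ((\<alpha>0 * t - 1) * x - \<alpha>1 * (\<alpha>1 + \<alpha>2 + \<alpha>3)) * y - t * x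
     - z^2 * w^4 / 4 + \<alpha>3 / 2 * z * w^3 + 1 / 4 * (2 * t * z^2 - \<alpha>3^2) * w^2
       - 1 / 2 * ((\<alpha>3 + 1) * t - 1) * z * w - t^2 * z^2 / 4
     + (x * y - \<alpha>1) * y * z * w) / t^2"

definition H_tilde ::
  "complex \<Rightarrow> complex \<Rightarrow> complex \<Rightarrow> complex \<Rightarrow>
   complex \<Rightarrow> complex \<Rightarrow> complex \<Rightarrow> complex \<Rightarrow> complex \<Rightarrow> complex" where
  "H_tilde \<alpha>0 \<alpha>1 \<alpha>2 \<alpha>3 t x y z w =
    (- t * x * (x - 1) * y^2 + (x^2 + ((\<alpha>0 + \<alpha>1) * t - 1) * x - \<alpha>1 * t) * y
       + (\<alpha>2 + \<alpha>3) * x - (\<alpha>0 * t - 1) * \<alpha>1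
     - z^2 * w^4 / 4 + \<alpha>3 / 2 * z * w^3 + 1 / 4 * (2 * t * z^2 - \<alpha>3^2) * w^2
       - 1 / 2 * ((\<alpha>0 + \<alpha>1 + 2 * \<alpha>2 + 2 * \<alpha>3) * t - 1) * z * w - t^2 * z^2 / 4
     - x * z * w) / t^2"

text \<open>
  Old variables in terms of the new ones. Written for the canonical pairs
  \<open>(q, p) = (y, - x)\<close> and \<open>(Q, P) = (Y, - X)\<close>, the first two components are
  \<open>q = 1 / Q\<close>, \<open>p = - (Q * P + A1) * Q\<close>. The printed source has these two formulas with
  \<open>x, y, X, Y\<close> in place of \<open>q, p, Q, P\<close>; read that way they do not carry the system of
  \<open>H_C3\<close> to that of \<open>H_tilde\<close>.
\<close>

definition change_of_variables ::
  "complex \<Rightarrow> complex \<times> complex \<times> complex \<times> complex \<Rightarrow> complex \<times> complex \<times> complex \<times> complex"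
  where
  "change_of_variables A1 = (\<lambda>(X, Y, Z, W). (- (X * Y - A1) * Y, 1 / Y, Z, W))"

end

theory Submission
  imports Defs
begin

text \<open>
  The change of variables \<open>\<phi> (X, Y, Z, W) = (A1 * Y - X * Y\<^sup>2, 1 / Y, Z, W)\<close> does not depend on \<open>t\<close>,
  and it is canonical where \<open>Y \<noteq> 0\<close>: from \<open>\<partial>x/\<partial>X = - Y\<^sup>2\<close>, \<open>\<partial>y/\<partial>X = 0\<close> and
  \<open>\<partial>y/\<partial>Y = - 1 / Y\<^sup>2\<close> one reads off \<open>dx \<and> dy = dX \<and> dY\<close>. It therefore carries the Hamiltonian
  system of \<open>H\<close> to that of \<open>H \<circ> \<phi>\<close>. Substituting \<open>\<phi>\<close> into the old Hamiltonian gives exactly the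
  new one (lemma \<open>H_C3_change_of_variables\<close>): the poles at \<open>Y = 0\<close> cancel, and the relation between
  the parameters is what makes the coefficients of \<open>z * w\<close> agree.

  The map \<open>\<phi>\<close> is moreover an involution. So the two Hamiltonians are related symmetrically, and
  a single transport statement (lemma \<open>solves_hamiltonian_system_change_of_variables\<close>), valid for
  every polynomial Hamiltonian, yields both directions of the equivalence. There, polynomiality
  serves to have a chain rule in the pair \<open>(x, y)\<close> expressed through the partial derivatives.
\<close>

section \<open>Polynomials in four variables\<close>

lemma is_polynomial4_monomial:
  "is_polynomial4 (\<lambda>x y z w. a * x ^ i * y ^ j * z ^ k * w ^ l)"
  unfolding is_polynomial4_def
  by (rule exI[of _ "{(i, j, k, l)}"], rule exI[of _ "\<lambda>_ _ _ _. a"]) simp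

lemma is_polynomial4_add:
  assumes "is_polynomial4 f" "is_polynomial4 g"
  shows "is_polynomial4 (\<lambda>x y z w. f x y z w + g x y z w)"
proof -
  obtain I c where I: "finite I"
    and f: "\<And>x y z w. f x y z w = (\<Sum>(i, j, k, l)\<in>I. c i j k l * x ^ i * y ^ j * z ^ k * w ^ l)"
    using assms(1) unfolding is_polynomial4_def by blast
  obtain J d where J: "finite J"
    and g: "\<And>x y z w. g x y z w = (\<Sum>(i, j, k, l)\<in>J. d i j k l * x ^ i * y ^ j * z ^ k * w ^ l)"
    using assms(2) unfolding is_polynomial4_def by blast
  \<comment> \<open>The index sets may overlap, so both coefficient families are extended by zero to the union.\<close>
  define e where "e i j k l = (if (i, j, k, l) \<in> I then c i j k l else 0)
    + (if (i, j, k, l) \<in> J then d i j k l else 0)" for i j k l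
  have "f x y z w + g x y z w = (\<Sum>(i, j, k, l)\<in>I \<union> J. e i j k l * x ^ i * y ^ j * z ^ k * w ^ l)"
    for x y z w
  proof -
    have "f x y z w = (\<Sum>(i, j, k, l)\<in>I \<union> J.
        (if (i, j, k, l) \<in> I then c i j k l else 0) * x ^ i * y ^ j * z ^ k * w ^ l)"
      unfolding f by (rule sum.mono_neutral_cong_left) (use I J in auto)
    moreover have "g x y z w = (\<Sum>(i, j, k, l)\<in>I \<union> J.
        (if (i, j, k, l) \<in> J then d i j k l else 0) * x ^ i * y ^ j * z ^ k * w ^ l)"
      unfolding g by (rule sum.mono_neutral_cong_left) (use I J in auto)
    ultimately show ?thesis
      by (simp add: e_def case_prod_unfold distrib_right flip: sum.distrib)
  qed
  with I J show ?thesis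
    unfolding is_polynomial4_def by (intro exI[of _ "I \<union> J"] exI[of _ e]) auto
qed

lemma is_polynomial4_sum:
  assumes "finite I" "\<And>i. i \<in> I \<Longrightarrow> is_polynomial4 (f i)"
  shows "is_polynomial4 (\<lambda>x y z w. \<Sum>i\<in>I. f i x y z w)"
  using assms
proof (induction I rule: finite_induct)
  case empty
  show ?case using is_polynomial4_monomial[of 0 0 0 0 0] by simp
next
  case (insert i I)
  then have "is_polynomial4 (\<lambda>x y z w. f i x y z w + (\<Sum>i\<in>I. f i x y z w))"
    by (intro is_polynomial4_add) auto
  with insert.hyps show ?case by simp
qed

text \<open>
  Expanding the product produces equal monomials several times; reading it as a double sum of
  monomials, each one a polynomial, leaves their collection to the closure under sums.
\<close>

lemma is_polynomial4_mult:
  assumes "is_polynomial4 f" "is_polynomial4 g"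
  shows "is_polynomial4 (\<lambda>x y z w. f x y z w * g x y z w)"
proof -
  obtain I c where I: "finite I"
    and f: "\<And>x y z w. f x y z w = (\<Sum>(i, j, k, l)\<in>I. c i j k l * x ^ i * y ^ j * z ^ k * w ^ l)"
    using assms(1) unfolding is_polynomial4_def by blast
  obtain J d where J: "finite J"
    and g: "\<And>x y z w. g x y z w = (\<Sum>(i, j, k, l)\<in>J. d i j k l * x ^ i * y ^ j * z ^ k * w ^ l)"
    using assms(2) unfolding is_polynomial4_def by blast
  have "f x y z w * g x y z w = (\<Sum>p\<in>I. \<Sum>q\<in>J.
      (case p of (i, j, k, l) \<Rightarrow> case q of (i', j', k', l') \<Rightarrow>
        c i j k l * d i' j' k' l' * x ^ (i + i') * y ^ (j + j') * z ^ (k + k') * w ^ (l + l')))"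
    for x y z w
    unfolding f g sum_product
    by (intro sum.cong refl) (simp add: power_add mult_ac split: prod.split)
  moreover have "is_polynomial4 (\<lambda>x y z w. \<Sum>p\<in>I. \<Sum>q\<in>J.
      (case p of (i, j, k, l) \<Rightarrow> case q of (i', j', k', l') \<Rightarrow>
        c i j k l * d i' j' k' l' * x ^ (i + i') * y ^ (j + j') * z ^ (k + k') * w ^ (l + l')))"
  proof (intro is_polynomial4_sum I J)
    fix p q :: "nat \<times> nat \<times> nat \<times> nat"
    show "is_polynomial4 (\<lambda>x y z w. case p of (i, j, k, l) \<Rightarrow> case q of (i', j', k', l') \<Rightarrow>
        c i j k l * d i' j' k' l' * x ^ (i + i') * y ^ (j + j') * z ^ (k + k') * w ^ (l + l'))"
      by (cases p; cases q) (simp add: is_polynomial4_monomial)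
  qed
  ultimately show ?thesis by simp
qed

lemma is_polynomial4_const: "is_polynomial4 (\<lambda>x y z w. a)"
  using is_polynomial4_monomial[of a 0 0 0 0] by simp

lemma is_polynomial4_coordinate:
  "is_polynomial4 (\<lambda>x y z w. x)" "is_polynomial4 (\<lambda>x y z w. y)"
  "is_polynomial4 (\<lambda>x y z w. z)" "is_polynomial4 (\<lambda>x y z w. w)"
  using is_polynomial4_monomial[of 1 1 0 0 0] is_polynomial4_monomial[of 1 0 1 0 0]
    is_polynomial4_monomial[of 1 0 0 1 0] is_polynomial4_monomial[of 1 0 0 0 1]
  by simp_all

lemma is_polynomial4_uminus:
  assumes "is_polynomial4 f"
  shows "is_polynomial4 (\<lambda>x y z w. - f x y z w)"
  using is_polynomial4_mult[OF is_polynomial4_const[of "- 1"] assms] by simp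

lemma is_polynomial4_diff:
  assumes "is_polynomial4 f" "is_polynomial4 g"
  shows "is_polynomial4 (\<lambda>x y z w. f x y z w - g x y z w)"
  using is_polynomial4_add[OF assms(1) is_polynomial4_uminus[OF assms(2)]] by simp

lemma is_polynomial4_divide_const:
  assumes "is_polynomial4 f"
  shows "is_polynomial4 (\<lambda>x y z w. f x y z w / a)"
  using is_polynomial4_mult[OF assms is_polynomial4_const[of "1 / a"]] by simp

lemma is_polynomial4_power:
  assumes "is_polynomial4 f"
  shows "is_polynomial4 (\<lambda>x y z w. f x y z w ^ n)"
  by (induction n) (auto intro: is_polynomial4_const is_polynomial4_mult assms)

lemmas is_polynomial4_intros =
  is_polynomial4_const is_polynomial4_coordinate is_polynomial4_add is_polynomial4_diff
  is_polynomial4_uminus is_polynomial4_mult is_polynomial4_power is_polynomial4_divide_const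

lemma is_polynomial4_H_C3: "is_polynomial4 (H_C3 \<alpha>0 \<alpha>1 \<alpha>2 \<alpha>3 t)"
  unfolding H_C3_def[abs_def] by (intro is_polynomial4_intros)

lemma is_polynomial4_H_tilde: "is_polynomial4 (H_tilde \<alpha>0 \<alpha>1 \<alpha>2 \<alpha>3 t)"
  unfolding H_tilde_def[abs_def] by (intro is_polynomial4_intros)

text \<open>
  The two coefficients are obtained before the curves: they depend only on the point, which lets
  the coordinate lines through it identify them with the partial derivatives.
\<close>

lemma polynomial4_derivative_along_curves:
  assumes "is_polynomial4 f"
  obtains a b where "\<And>g h g' h' s. (g has_field_derivative g') (at s) \<Longrightarrow>
      (h has_field_derivative h') (at s) \<Longrightarrow> g s = x \<Longrightarrow> h s = y \<Longrightarrow>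
      ((\<lambda>r. f (g r) (h r) z w) has_field_derivative a * g' + b * h') (at s)"
proof -
  obtain I c where
    f: "\<And>x y z w. f x y z w = (\<Sum>(i, j, k, l)\<in>I. c i j k l * x ^ i * y ^ j * z ^ k * w ^ l)"
    using assms unfolding is_polynomial4_def by blast
  let ?a = "\<Sum>(i, j, k, l)\<in>I. c i j k l * (of_nat i * x ^ (i - 1)) * y ^ j * z ^ k * w ^ l"
  let ?b = "\<Sum>(i, j, k, l)\<in>I. c i j k l * x ^ i * (of_nat j * y ^ (j - 1)) * z ^ k * w ^ l"
  have "((\<lambda>r. f (g r) (h r) z w) has_field_derivative ?a * g' + ?b * h') (at s)"
    if "(g has_field_derivative g') (at s)" "(h has_field_derivative h') (at s)"
      "g s = x" "h s = y" for g h g' h' s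
    unfolding f case_prod_unfold sum_distrib_right sum.distrib[symmetric]
    by (rule DERIV_sum) (auto intro!: derivative_eq_intros that(1,2) simp: that(3,4) algebra_simps)
  then show thesis by (rule that)
qed

lemma polynomial4_chain_rule:
  assumes f: "is_polynomial4 f"
    and g: "(g has_field_derivative g') (at s)" and h: "(h has_field_derivative h') (at s)"
  shows "((\<lambda>r. f (g r) (h r) z w) has_field_derivative
      deriv (\<lambda>u. f u (h s) z w) (g s) * g' + deriv (\<lambda>v. f (g s) v z w) (h s) * h') (at s)"
proof -
  obtain a b where ab: "\<And>p q p' q' r. (p has_field_derivative p') (at r) \<Longrightarrow>
      (q has_field_derivative q') (at r) \<Longrightarrow> p r = g s \<Longrightarrow> q r = h s \<Longrightarrow>
      ((\<lambda>r. f (p r) (q r) z w) has_field_derivative a * p' + b * q') (at r)"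
    using polynomial4_derivative_along_curves[OF f, of "g s" "h s" z w] by blast
  have "deriv (\<lambda>u. f u (h s) z w) (g s) = a"
    using ab[OF DERIV_ident DERIV_const] by (auto intro: DERIV_imp_deriv)
  moreover have "deriv (\<lambda>v. f (g s) v z w) (h s) = b"
    using ab[OF DERIV_const DERIV_ident] by (auto intro: DERIV_imp_deriv)
  ultimately show ?thesis
    using ab[OF g h] by simp
qed

section \<open>The change of variables as a canonical involution\<close>

lemma change_of_variables_eq:
  "change_of_variables A (x, y, z, w) = (A * y - x * y\<^sup>2, 1 / y, z, w)"
  by (simp add: change_of_variables_def algebra_simps power2_eq_square)

lemma change_of_variables_involution:
  assumes "y \<noteq> 0"
  shows "change_of_variables A (change_of_variables A (x, y, z, w)) = (x, y, z, w)"
  using assms by (simp add: change_of_variables_eq field_simps power2_eq_square)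

text \<open>
  Canonicity in the form in which it is used: since the inverse of the change of variables is
  the change of variables itself, both the new variables along a solution and the new Hamiltonian
  are differentiated by one and the same formula, and the two results agree because the Jacobian
  determinant in \<open>(x, y)\<close> equals one.
\<close>

lemma solves_hamiltonian_system_change_of_variables:
  assumes "open S"
    and poly: "\<And>t. t \<in> S \<Longrightarrow> is_polynomial4 (H t)"
    and K: "\<And>t X Y Z W. t \<in> S \<Longrightarrow> Y \<noteq> 0 \<Longrightarrow> K t X Y Z W = H t (A * Y - X * Y\<^sup>2) (1 / Y) Z W"
    and new: "\<And>t. t \<in> S \<Longrightarrow> y t \<noteq> 0 \<and>
      (X t, Y t, Z t, W t) = change_of_variables A (x t, y t, z t, w t)"
    and sol: "solves_hamiltonian_system H S x y z w"
  shows "solves_hamiltonian_system K S X Y Z W"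
  unfolding solves_hamiltonian_system_def
proof
  fix t assume t: "t \<in> S"
  define Hx where "Hx = deriv (\<lambda>u. H t u (y t) (z t) (w t)) (x t)"
  define Hy where "Hy = deriv (\<lambda>v. H t (x t) v (z t) (w t)) (y t)"
  have X: "X s = A * y s - x s * (y s)\<^sup>2" and Y: "Y s = 1 / y s"
    and Z: "Z s = z s" and W: "W s = w s" and y0: "y s \<noteq> 0" if "s \<in> S" for s
    using new[OF that] by (auto simp: change_of_variables_eq)
  have Y0: "Y t \<noteq> 0"
    using Y y0 t by simp
  have x_eq: "A * Y t - X t * (Y t)\<^sup>2 = x t" and y_eq: "1 / Y t = y t"
    using y0[OF t] by (simp_all add: X Y t field_simps power2_eq_square)
  have dx: "(x has_field_derivative Hy) (at t)" and dy: "(y has_field_derivative - Hx) (at t)"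
    using sol t unfolding solves_hamiltonian_system_def Hx_def Hy_def by auto
  have dz: "(z has_field_derivative deriv (\<lambda>v. H t (x t) (y t) (z t) v) (w t)) (at t)"
    and dw: "(w has_field_derivative - deriv (\<lambda>u. H t (x t) (y t) u (w t)) (z t)) (at t)"
    using sol t unfolding solves_hamiltonian_system_def by auto

  have dX: "(X has_field_derivative (2 * x t * y t - A) * Hx - (y t)\<^sup>2 * Hy) (at t)"
  proof (rule has_field_derivative_transform_within_open[OF _ \<open>open S\<close> t])
    show "((\<lambda>s. A * y s - x s * (y s)\<^sup>2) has_field_derivative
        (2 * x t * y t - A) * Hx - (y t)\<^sup>2 * Hy) (at t)"
      by (auto intro!: derivative_eq_intros dx dy simp: algebra_simps power2_eq_square)
  qed (simp add: X)
  have dY: "(Y has_field_derivative Hx / (y t)\<^sup>2) (at t)"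
  proof (rule has_field_derivative_transform_within_open[OF _ \<open>open S\<close> t])
    show "((\<lambda>s. 1 / y s) has_field_derivative Hx / (y t)\<^sup>2) (at t)"
      using y0[OF t] by (auto intro!: derivative_eq_intros dy simp: power2_eq_square)
  qed (simp add: Y)

  have "((\<lambda>u. H t (A * Y t - u * (Y t)\<^sup>2) (1 / Y t) (z t) (w t)) has_field_derivative
      deriv (\<lambda>u. H t u (1 / Y t) (z t) (w t)) (A * Y t - X t * (Y t)\<^sup>2) * - (Y t)\<^sup>2
        + deriv (\<lambda>v. H t (A * Y t - X t * (Y t)\<^sup>2) v (z t) (w t)) (1 / Y t) * 0) (at (X t))"
    by (rule polynomial4_chain_rule[OF poly[OF t]]) (auto intro!: derivative_eq_intros)
  then have KX: "deriv (\<lambda>u. K t u (Y t) (Z t) (W t)) (X t) = - (Hx / (y t)\<^sup>2)"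
    unfolding x_eq y_eq Hx_def[symmetric]
    by (intro DERIV_imp_deriv) (simp add: K t Y0 Y y0 Z W power_divide)

  have "((\<lambda>v. H t (A * v - X t * v\<^sup>2) (1 / v) (z t) (w t)) has_field_derivative
      deriv (\<lambda>u. H t u (1 / Y t) (z t) (w t)) (A * Y t - X t * (Y t)\<^sup>2) * (A - 2 * X t * Y t)
        + deriv (\<lambda>v. H t (A * Y t - X t * (Y t)\<^sup>2) v (z t) (w t)) (1 / Y t) * - (1 / (Y t)\<^sup>2))
      (at (Y t))"
    by (rule polynomial4_chain_rule[OF poly[OF t]])
      (use Y0 in \<open>auto intro!: derivative_eq_intros simp: power2_eq_square\<close>)
  \<comment> \<open>The formula for the new Hamiltonian holds off the hyperplane \<open>Y = 0\<close> only, hence on a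
    neighbourhood of the point, which is enough to differentiate it.\<close>
  then have "((\<lambda>v. K t (X t) v (Z t) (W t)) has_field_derivative
      Hx * (A - 2 * X t * Y t) + Hy * - (1 / (Y t)\<^sup>2)) (at (Y t))"
    unfolding x_eq y_eq Hx_def[symmetric] Hy_def[symmetric]
    by (rule has_field_derivative_transform_within_open[where S = "- {0}"])
      (use Y0 in \<open>auto simp: K t Z W\<close>)
  moreover have "Hx * (A - 2 * X t * Y t) + Hy * - (1 / (Y t)\<^sup>2)
      = (2 * x t * y t - A) * Hx - (y t)\<^sup>2 * Hy"
    using y0[OF t] by (simp add: X Y t field_simps power2_eq_square)
  ultimately have KY: "deriv (\<lambda>v. K t (X t) v (Z t) (W t)) (Y t)
      = (2 * x t * y t - A) * Hx - (y t)\<^sup>2 * Hy"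
    by (metis DERIV_imp_deriv)

  have Kzw: "K t (X t) (Y t) u v = H t (x t) (y t) u v" for u v
    using K[OF t Y0] x_eq y_eq by simp
  have dZ: "(Z has_field_derivative deriv (\<lambda>v. K t (X t) (Y t) (Z t) v) (W t)) (at t)"
    by (rule has_field_derivative_transform_within_open[OF _ \<open>open S\<close> t])
      (use dz in \<open>simp_all add: Kzw Z W t\<close>)
  have dW: "(W has_field_derivative - deriv (\<lambda>u. K t (X t) (Y t) u (W t)) (Z t)) (at t)"
    by (rule has_field_derivative_transform_within_open[OF _ \<open>open S\<close> t])
      (use dw in \<open>simp_all add: Kzw Z W t\<close>)
  show "(X has_field_derivative deriv (\<lambda>v. K t (X t) v (Z t) (W t)) (Y t)) (at t) \<and>
      (Y has_field_derivative - deriv (\<lambda>u. K t u (Y t) (Z t) (W t)) (X t)) (at t) \<and>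
      (Z has_field_derivative deriv (\<lambda>v. K t (X t) (Y t) (Z t) v) (W t)) (at t) \<and>
      (W has_field_derivative - deriv (\<lambda>u. K t (X t) (Y t) u (W t)) (Z t)) (at t)"
    using dX dY dZ dW by (simp add: KX KY)
qed

section \<open>The two Hamiltonians\<close>

text \<open>
  In the new variables \<open>x * y = A1 - X * Y\<close>. The terms of the old Hamiltonian with a
  denominator \<open>Y\<close> have the numerator
  \<open>(A1 - X * Y)\<^sup>2 - (2 * A1 + A2 + A3) * (A1 - X * Y) + A1 * (A1 + A2 + A3)\<close>, which
  is the multiple \<open>X * Y * (X * Y + A2 + A3)\<close> of \<open>Y\<close>, so that the pole cancels.
\<close>

lemma H_C3_change_of_variables:
  assumes sum: "A0 + A1 + 2 * A2 + A3 = 1" and Y: "Y \<noteq> 0"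
  shows "H_tilde A0 A1 A2 A3 t X Y Z W = H_C3 (A0 - A1) A1 A2 A3 t (A1 * Y - X * Y\<^sup>2) (1 / Y) Z W"
proof -
  let ?x = "A1 * Y - X * Y\<^sup>2" and ?y = "1 / Y"
  have A0: "A0 = 1 - A1 - 2 * A2 - A3"
    using sum by (simp add: algebra_simps)
  have xy: "?x * ?y = A1 - X * Y"
    using Y by (simp add: field_simps power2_eq_square)
  have "?x\<^sup>2 * ?y ^ 3 - (2 * A1 + A2 + A3) * ?x * ?y\<^sup>2 + A1 * (A1 + A2 + A3) * ?y
      = ((?x * ?y)\<^sup>2 - (2 * A1 + A2 + A3) * (?x * ?y) + A1 * (A1 + A2 + A3)) * ?y"
    by (simp only: power2_eq_square power3_eq_cube) algebra
  also have "\<dots> = X * (X * Y + A2 + A3) * (Y * ?y)"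
    unfolding xy by algebra
  also have "\<dots> = X\<^sup>2 * Y + (A2 + A3) * X"
    using Y by (simp add: algebra_simps power2_eq_square)
  finally have poles: "?x\<^sup>2 * ?y ^ 3 - (2 * A1 + A2 + A3) * ?x * ?y\<^sup>2 + A1 * (A1 + A2 + A3) * ?y
      = X\<^sup>2 * Y + (A2 + A3) * X" .
  have xyy: "(?x * ?y - A1) * ?y = - X"
    unfolding xy using Y by simp
  have "?x\<^sup>2 * ?y ^ 3 - (t * ?x + 2 * A1 + A2 + A3) * ?x * ?y\<^sup>2
      - (((A0 - A1) * t - 1) * ?x - A1 * (A1 + A2 + A3)) * ?y - t * ?x
    = (?x\<^sup>2 * ?y ^ 3 - (2 * A1 + A2 + A3) * ?x * ?y\<^sup>2 + A1 * (A1 + A2 + A3) * ?y)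
      - t * (?x * ?y)\<^sup>2 - ((A0 - A1) * t - 1) * (?x * ?y) - t * ?x"
    by algebra
  also have "\<dots> = - t * X * (X - 1) * Y\<^sup>2 + (X\<^sup>2 + ((A0 + A1) * t - 1) * X - A1 * t) * Y
      + (A2 + A3) * X - (A0 * t - 1) * A1"
    unfolding poles unfolding xy by algebra
  finally have main: "?x\<^sup>2 * ?y ^ 3 - (t * ?x + 2 * A1 + A2 + A3) * ?x * ?y\<^sup>2
      - (((A0 - A1) * t - 1) * ?x - A1 * (A1 + A2 + A3)) * ?y - t * ?x
    = - t * X * (X - 1) * Y\<^sup>2 + (X\<^sup>2 + ((A0 + A1) * t - 1) * X - A1 * t) * Y
      + (A2 + A3) * X - (A0 * t - 1) * A1" .
  have zw: "A0 + A1 + 2 * A2 + 2 * A3 = A3 + 1"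
    by (simp add: A0)
  show ?thesis
    unfolding H_C3_def H_tilde_def main xyy zw by simp
qed

theorem theorem4p1:
  fixes \<alpha>0 \<alpha>1 \<alpha>2 \<alpha>3 A0 A1 A2 A3 :: complex
  assumes "\<alpha>0 + 2 * \<alpha>1 + 2 * \<alpha>2 + \<alpha>3 = 1"
    and "\<alpha>0 = A0 - A1" and "\<alpha>1 = A1" and "\<alpha>2 = A2" and "\<alpha>3 = A3"
  shows "A0 + A1 + 2 * A2 + A3 = 1
    \<and> (\<forall>t. t \<noteq> 0 \<longrightarrow> is_polynomial4 (H_tilde A0 A1 A2 A3 t))
    \<and> (\<forall>S x y z w X Y Z W.
          open S \<and> 0 \<notin> S \<and>
          (\<forall>t\<in>S. Y t \<noteq> 0 \<and>
             (x t, y t, z t, w t) = change_of_variables A1 (X t, Y t, Z t, W t)) \<longrightarrow>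
          (solves_hamiltonian_system (H_C3 \<alpha>0 \<alpha>1 \<alpha>2 \<alpha>3) S x y z w \<longleftrightarrow>
           solves_hamiltonian_system (H_tilde A0 A1 A2 A3) S X Y Z W))"
proof (intro conjI allI impI)
  show sum: "A0 + A1 + 2 * A2 + A3 = 1"
    using assms by (simp add: algebra_simps)
  show "is_polynomial4 (H_tilde A0 A1 A2 A3 t)" for t
    by (rule is_polynomial4_H_tilde)
  fix S :: "complex set" and x y z w X Y Z W :: "complex \<Rightarrow> complex"
  assume "open S \<and> 0 \<notin> S \<and> (\<forall>t\<in>S. Y t \<noteq> 0 \<and>
    (x t, y t, z t, w t) = change_of_variables A1 (X t, Y t, Z t, W t))"
  then have "open S" and old: "\<And>t. t \<in> S \<Longrightarrow> Y t \<noteq> 0 \<and>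
      (x t, y t, z t, w t) = change_of_variables A1 (X t, Y t, Z t, W t)"
    by auto
  have new: "y t \<noteq> 0 \<and> (X t, Y t, Z t, W t) = change_of_variables A1 (x t, y t, z t, w t)"
    if "t \<in> S" for t
  proof -
    have "y t = 1 / Y t"
      using old[OF that] by (simp add: change_of_variables_eq)
    with old[OF that] show ?thesis
      by (metis change_of_variables_involution divide_eq_0_iff zero_neq_one)
  qed
  have H_tilde_eq: "H_tilde A0 A1 A2 A3 t q p u v
      = H_C3 \<alpha>0 \<alpha>1 \<alpha>2 \<alpha>3 t (A1 * p - q * p\<^sup>2) (1 / p) u v" if "p \<noteq> 0" for t q p u v
    using H_C3_change_of_variables[OF sum that] assms by simp
  \<comment> \<open>The same identity evaluated at the image point, since the change of variables is an involution.\<close>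
  have H_C3_eq: "H_C3 \<alpha>0 \<alpha>1 \<alpha>2 \<alpha>3 t q p u v
      = H_tilde A0 A1 A2 A3 t (A1 * p - q * p\<^sup>2) (1 / p) u v" if "p \<noteq> 0" for t q p u v
    using H_tilde_eq[of "1 / p" t "A1 * p - q * p\<^sup>2" u v]
      change_of_variables_involution[OF that, of A1 q u v] that
    by (simp add: change_of_variables_eq)
  show "solves_hamiltonian_system (H_C3 \<alpha>0 \<alpha>1 \<alpha>2 \<alpha>3) S x y z w \<longleftrightarrow>
      solves_hamiltonian_system (H_tilde A0 A1 A2 A3) S X Y Z W"
  proof
    assume sol: "solves_hamiltonian_system (H_C3 \<alpha>0 \<alpha>1 \<alpha>2 \<alpha>3) S x y z w"
    show "solves_hamiltonian_system (H_tilde A0 A1 A2 A3) S X Y Z W"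
      by (rule solves_hamiltonian_system_change_of_variables
          [OF \<open>open S\<close> is_polynomial4_H_C3 _ new sol]) (simp add: H_tilde_eq)
  next
    assume sol: "solves_hamiltonian_system (H_tilde A0 A1 A2 A3) S X Y Z W"
    show "solves_hamiltonian_system (H_C3 \<alpha>0 \<alpha>1 \<alpha>2 \<alpha>3) S x y z w"
      by (rule solves_hamiltonian_system_change_of_variables
          [OF \<open>open S\<close> is_polynomial4_H_tilde _ old sol]) (simp add: H_C3_eq)
  qed
qed

end
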